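(* For integers $n,m,p$, let $\mathfrak a_{n,m,p}$ be the number of inversion sequences $\sigma\in\mathcal{I}_n(000,201)$ such that $\max(\sigma)=m$ and the value $m$ appears exactly once in $\sigma$, at position $p$. Then for all $n\geqslant 2$, $$|\mathcal{I}_n(000,201)|=\sum_{m=0}^{n-1}\sum_{p=m+1}^{n}\Big(\mathfrak a_{n,m,p}+(n-p)\,\mathfrak a_{n-1,m,p}\Big).$$
   Context: For $n\in\mathbb N$, an inversion sequence of size $n$ is a sequence $\sigma=(\sigma_1,\dots,\sigma_n)\in\mathbb N^n$ with $\sigma_i<i$ for all $i$. An integer sequence contains a pattern $\rho$ (a finite integer sequence such as $000$ or $201$) if it has a subsequence order-isomorphic to $\rho$, and avoids $\rho$ otherwise. $\mathcal{I}_n(P)$ denotes the set of inversion sequences of size $n$ avoiding every pattern in the set $P$. $\max(\sigma)$ is the largest entry of $\sigma$. *)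

theory Defs
  imports Main "HOL-Library.Sublist"
begin

definition order_iso :: "'a::linorder list \<Rightarrow> 'b::linorder list \<Rightarrow> bool" where
  "order_iso xs ys \<longleftrightarrow>
     length xs = length ys \<and>
     (\<forall>i<length xs. \<forall>j<length xs.
        (xs ! i < xs ! j \<longleftrightarrow> ys ! i < ys ! j) \<and> (xs ! i = xs ! j \<longleftrightarrow> ys ! i = ys ! j))"

definition contains_pattern :: "'a::linorder list \<Rightarrow> 'b::linorder list \<Rightarrow> bool" where
  "contains_pattern s r \<longleftrightarrow> (\<exists>t. subseq t s \<and> order_iso t r)"

(* The entry in position i (counted from 1) of a list s is s ! (i - 1). *)

definition inversion_seq :: "nat \<Rightarrow> nat list \<Rightarrow> bool" where
  "inversion_seq n s \<longleftrightarrow> length s = n \<and> (\<forall>i\<in>{1..n}. s ! (i - 1) < i)"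

definition inv_seqs_avoiding :: "nat \<Rightarrow> int list set \<Rightarrow> nat list set" where
  "inv_seqs_avoiding n P = {s. inversion_seq n s \<and> (\<forall>r\<in>P. \<not> contains_pattern s r)}"

definition single_max_count :: "nat \<Rightarrow> nat \<Rightarrow> nat \<Rightarrow> nat" where
  "single_max_count n m p =
     card {s \<in> inv_seqs_avoiding n {[0, 0, 0], [2, 0, 1]}.
             Max (set s) = m \<and> count_list s m = 1 \<and> p \<in> {1..n} \<and> s ! (p - 1) = m}"

(* The cardinalities involved are those of finite sets. *)
lemma finite_inv_seqs_avoiding: "finite (inv_seqs_avoiding n P)"
proof (rule finite_subset)
  show "inv_seqs_avoiding n P \<subseteq> {s. set s \<subseteq> {..<n} \<and> length s = n}"
  proof
    fix s assume "s \<in> inv_seqs_avoiding n P"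
    then have len: "length s = n" and lt: "\<And>i. i \<in> {1..n} \<Longrightarrow> s ! (i - 1) < i"
      by (auto simp: inv_seqs_avoiding_def inversion_seq_def)
    have "s ! k < n" if "k < n" for k
      using lt[of "Suc k"] that by simp
    with len show "s \<in> {s. set s \<subseteq> {..<n} \<and> length s = n}"
      by (auto simp: in_set_conv_nth)
  qed
  show "finite {s. set s \<subseteq> {..<n} \<and> length s = n}"
    by (rule finite_lists_length_eq) simp
qed

end

theory Submission
  imports Defs
begin

text \<open>
  Avoiding 000 means that the maximum \<open>m\<close> occurs once or twice. If it occurs twice, first at
  position \<open>p\<close>, deleting the second occurrence gives a sequence of size \<open>n - 1\<close> in which \<open>m\<close> occurs
  once, at \<open>p\<close>. Conversely, a second \<open>m\<close> can be inserted at any of the \<open>n - p\<close> places to the right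
  of \<open>p\<close>: in an occurrence of 201 a maximal entry can only play the role of 2, where the first \<open>m\<close>
  can replace it, and the entries right of \<open>p\<close> are smaller than \<open>m < p\<close>, so that shifting
  them by one place does not affect the inversion sequence condition.
\<close>

section \<open>Pattern avoidance\<close>

text \<open>The head can only play the role of 2, so it suffices to forbid an ascent below it among
  later entries. The recursive form lets insertions be treated by list induction.\<close>

fun avoids_201 :: "'a::linorder list \<Rightarrow> bool" where
  "avoids_201 [] \<longleftrightarrow> True"
| "avoids_201 (a # s) \<longleftrightarrow> avoids_201 s \<and> sorted_wrt (\<lambda>b c. c \<le> b \<or> a \<le> c) s"

text \<open>An embedding either skips \<open>x\<close> or matches it with \<open>a\<close>. The
  disjuncts may overlap, which avoids a case split on \<open>a = x\<close> in the inductions that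
  unfold this.\<close>

lemma subseq_Cons_Cons_iff:
  "subseq (a # t) (x # s) \<longleftrightarrow> subseq (a # t) s \<or> (a = x \<and> subseq t s)"
  by (metis subseq_Cons' subseq_Cons2_iff list_emb_Cons)

lemma sorted_wrt_iff_subseq: "sorted_wrt P s \<longleftrightarrow> (\<forall>b c. subseq [b, c] s \<longrightarrow> P b c)"
proof (induction s)
  case (Cons x s)
  show ?case
    unfolding sorted_wrt.simps Cons.IH subseq_Cons_Cons_iff subseq_singleton_left by blast
qed simp

lemma avoids_201_iff_subseq:
  "avoids_201 s \<longleftrightarrow> \<not> (\<exists>a b c. subseq [a, b, c] s \<and> b < c \<and> c < a)"
proof (induction s)
  case (Cons x s)
  show ?case
    unfolding avoids_201.simps Cons.IH subseq_Cons_Cons_iff sorted_wrt_iff_subseq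
    by (auto simp flip: not_less)
qed simp

lemma order_iso_length_3:
  assumes "order_iso t [x, y, z]"
  obtains a b c where "t = [a, b, c]"
  using assms by (auto simp: order_iso_def length_Suc_conv)

lemma All_less_3: "(\<forall>i<Suc (Suc (Suc 0)). P i) \<longleftrightarrow> P 0 \<and> P (Suc 0) \<and> P (Suc (Suc 0))"
  by (auto simp: less_Suc_eq)

lemma order_iso_201: "order_iso [a, b, c] [2, 0, 1 :: int] \<longleftrightarrow> b < c \<and> c < a"
  by (auto simp: order_iso_def All_less_3)

lemma order_iso_000: "order_iso [a, b, c] [0, 0, 0 :: int] \<longleftrightarrow> a = b \<and> b = c"
  by (auto simp: order_iso_def All_less_3)

lemma contains_201_iff: "contains_pattern s [2, 0, 1 :: int] \<longleftrightarrow> \<not> avoids_201 s"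
  unfolding avoids_201_iff_subseq contains_pattern_def
  by (metis order_iso_201 order_iso_length_3)

text \<open>Turns 000 into a multiplicity condition. Matching the head uses up one copy of
  \<open>a\<close>, so the induction must leave \<open>k\<close> arbitrary.\<close>

lemma subseq_replicate_iff: "subseq (replicate k a) s \<longleftrightarrow> k \<le> count_list s a"
proof (induction s arbitrary: k)
  case Nil
  show ?case by (cases k) auto
next
  case (Cons x s)
  show ?case
  proof (cases k)
    case (Suc j)
    have "subseq (replicate k a) (x # s) \<longleftrightarrow>
        Suc j \<le> count_list s a \<or> (a = x \<and> j \<le> count_list s a)"
      unfolding Suc replicate_Suc subseq_Cons_Cons_iff
      by (simp only: Cons.IH flip: replicate_Suc)
    then show ?thesis
      using Suc by auto
  qed simp
qed

lemma contains_000_iff: "contains_pattern s [0, 0, 0 :: int] \<longleftrightarrow> (\<exists>a. count_list s a \<ge> 3)"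
proof -
  have "contains_pattern s [0, 0, 0 :: int] \<longleftrightarrow> (\<exists>a. subseq [a, a, a] s)"
    unfolding contains_pattern_def by (metis order_iso_000 order_iso_length_3)
  also have "\<dots> \<longleftrightarrow> (\<exists>a. count_list s a \<ge> 3)"
    by (simp flip: subseq_replicate_iff add: numeral_3_eq_3)
  finally show ?thesis .
qed

text \<open>Working form of membership: with indices from 0 the bound \<open>< i\<close> becomes
  \<open>\<le> k\<close>, and both patterns are replaced by list conditions.\<close>

lemma inv_seqs_avoiding_iff:
  "s \<in> inv_seqs_avoiding n {[0, 0, 0], [2, 0, 1]} \<longleftrightarrow>
     length s = n \<and> (\<forall>k<n. s ! k \<le> k) \<and> avoids_201 s \<and> (\<forall>a. count_list s a \<le> 2)"
proof -
  have "(\<forall>i\<in>{1..n}. s ! (i - 1) < i) \<longleftrightarrow> (\<forall>k<n. s ! k \<le> k)"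
    by (simp only: flip: image_Suc_lessThan) (auto simp: less_Suc_eq_le)
  moreover have "(\<nexists>a. count_list s a \<ge> 3) \<longleftrightarrow> (\<forall>a. count_list s a \<le> 2)"
    by (simp add: not_le numeral_3_eq_3 numeral_2_eq_2 less_Suc_eq_le)
  ultimately show ?thesis
    by (auto simp: inv_seqs_avoiding_def inversion_seq_def contains_201_iff contains_000_iff)
qed

section \<open>Inserting a second maximum\<close>

lemma avoids_201_insert_max:
  assumes "\<forall>x\<in>set (xs @ ys @ zs). x \<le> m"
  shows "avoids_201 (xs @ m # ys @ m # zs) \<longleftrightarrow> avoids_201 (xs @ m # ys @ zs)"
proof -
  \<comment> \<open>With \<open>m\<close> kept in front during the induction over \<open>ys\<close>,
    the condition it imposes on \<open>zs\<close> already covers that of the second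
    \<open>m\<close>.\<close>
  have "avoids_201 (m # ys @ m # zs) \<longleftrightarrow> avoids_201 (m # ys @ zs)"
    using assms by (induction ys) (auto simp: sorted_wrt_append)
  \<comment> \<open>For an entry \<open>x\<close> of \<open>xs\<close>, no pair involving the new
    \<open>m\<close> is an obstruction: \<open>m\<close> as the later member is at least
    \<open>x\<close>, as the earlier one at least its partner.\<close>
  then show ?thesis
    using assms by (induction xs) (auto simp: sorted_wrt_append)
qed

text \<open>Every index in \<open>v\<close> is at least \<open>length u\<close>, so the bound there
  is automatic and insensitive to shifts.\<close>

lemma all_nth_le_append:
  fixes u v :: "nat list"
  assumes "\<forall>x\<in>set v. x \<le> length u"
  shows "(\<forall>k<length (u @ v). (u @ v) ! k \<le> k) \<longleftrightarrow> (\<forall>k<length u. u ! k \<le> k)"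
proof -
  have "(u @ v) ! k \<le> k" if "k < length (u @ v)" "\<not> k < length u" for k
  proof -
    have "v ! (k - length u) \<in> set v"
      using that by (intro nth_mem) auto
    then show ?thesis
      using assms that by (fastforce simp: nth_append)
  qed
  then show ?thesis
    by (auto simp: nth_append)
qed

lemma inv_seqs_avoiding_insert_max:
  assumes "\<forall>x\<in>set (xs @ ys @ zs). x < m"
  shows "xs @ m # ys @ m # zs \<in> inv_seqs_avoiding (Suc n) {[0, 0, 0], [2, 0, 1]} \<longleftrightarrow>
         xs @ m # ys @ zs \<in> inv_seqs_avoiding n {[0, 0, 0], [2, 0, 1]}"
proof -
  let ?s = "xs @ m # ys @ m # zs" and ?t = "xs @ m # ys @ zs"
  have "(\<forall>k<length ?s. ?s ! k \<le> k) \<longleftrightarrow> (\<forall>k<length ?t. ?t ! k \<le> k)"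
  proof (cases "m \<le> length xs")
    \<comment> \<open>All entries after the first \<open>m\<close> are at most
      \<open>length xs\<close>, so both bounds reduce to the common prefix
      \<open>xs @ [m]\<close>.\<close>
    case True
    then have "\<forall>x\<in>set (ys @ m # zs). x \<le> length (xs @ [m])"
        "\<forall>x\<in>set (ys @ zs). x \<le> length (xs @ [m])"
      using assms by (auto simp: less_le_trans less_imp_le dest!: bspec intro: le_SucI le_trans)
    from this[THEN all_nth_le_append] show ?thesis
      by simp
  next
    \<comment> \<open>The first \<open>m\<close> violates the bound in both lists, so both sides are
      false.\<close>
    case False
    then have "\<not> ?s ! length xs \<le> length xs" "\<not> ?t ! length xs \<le> length xs"
      by (simp_all add: nth_append)
    then show ?thesis
      by (metis length_append length_Cons add_Suc_right le_add1 le_imp_less_Suc)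
  qed
  moreover have "(\<forall>a. count_list ?s a \<le> 2) \<longleftrightarrow> (\<forall>a. count_list ?t a \<le> 2)"
  proof -
    have "m \<notin> set (xs @ ys @ zs)"
      using assms by blast
    then have "count_list ?s m \<le> 2" "count_list ?t m \<le> 2"
      by (simp_all add: count_list_0_iff)
    moreover have "count_list ?s a = count_list ?t a" if "a \<noteq> m" for a
      using that by simp
    ultimately show ?thesis by metis
  qed
  moreover have "avoids_201 ?s \<longleftrightarrow> avoids_201 ?t"
    using assms by (intro avoids_201_insert_max) (blast intro: less_imp_le)
  moreover have "length ?s = Suc n \<longleftrightarrow> length ?t = n"
    by simp
  ultimately show ?thesis
    unfolding inv_seqs_avoiding_iff by metis
qed

section \<open>Classification by the maximum and its first position\<close>

text \<open>Stated by splitting at \<open>m\<close> instead of through \<open>Max\<close> and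
  \<open>count_list\<close>, so that insertion and deletion become list surgery; \<open>Suc\<close>
  makes \<open>p\<close> count from 1.\<close>

definition single_max_seqs :: "nat \<Rightarrow> nat \<Rightarrow> nat \<Rightarrow> nat list set" where
  "single_max_seqs n m p = {s \<in> inv_seqs_avoiding n {[0, 0, 0], [2, 0, 1]}.
     \<exists>xs ys. s = xs @ m # ys \<and> Suc (length xs) = p \<and> (\<forall>x\<in>set (xs @ ys). x < m)}"

definition double_max_seqs :: "nat \<Rightarrow> nat \<Rightarrow> nat \<Rightarrow> nat list set" where
  "double_max_seqs n m p = {s \<in> inv_seqs_avoiding n {[0, 0, 0], [2, 0, 1]}.
     \<exists>xs ys zs. s = xs @ m # ys @ m # zs \<and> Suc (length xs) = p \<and>
       (\<forall>x\<in>set (xs @ ys @ zs). x < m)}"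

lemma Max_set_eqI:
  fixes m :: "'a::linorder"
  shows "m \<in> set s \<Longrightarrow> \<forall>x\<in>set s. x \<le> m \<Longrightarrow> Max (set s) = m"
  by (intro Max_eqI) auto

lemma single_max_count_eq: "single_max_count n m p = card (single_max_seqs n m p)"
proof -
  have "(Max (set s) = m \<and> count_list s m = 1 \<and> p \<in> {1..n} \<and> s ! (p - 1) = m) \<longleftrightarrow>
        (\<exists>xs ys. s = xs @ m # ys \<and> Suc (length xs) = p \<and> (\<forall>x\<in>set (xs @ ys). x < m))"
    (is "?L \<longleftrightarrow> ?R") if "length s = n" for s
  proof
    assume L: ?L
    \<comment> \<open>The entry at position \<open>p\<close> has index \<open>p - 1\<close>;
      \<open>p \<in> {1..n}\<close> makes this cut valid.\<close>
    define xs ys where "xs = take (p - 1) s" and "ys = drop p s"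
    have s: "s = xs @ m # ys"
      using L that id_take_nth_drop[of "p - 1" s] by (auto simp: xs_def ys_def)
    then have "count_list xs m = 0" "count_list ys m = 0"
      using L by auto
    then have "m \<notin> set (xs @ ys)"
      by (simp add: count_list_0_iff)
    moreover have "\<forall>x\<in>set s. x \<le> m"
      using L by auto
    ultimately have "\<forall>x\<in>set (xs @ ys). x < m"
      unfolding s by (metis Un_iff le_neq_implies_less list.set_intros(2) set_append)
    moreover have "Suc (length xs) = p"
      using L that by (auto simp: xs_def)
    ultimately show ?R
      using s by blast
  next
    assume ?R
    then obtain xs ys where s: "s = xs @ m # ys" "Suc (length xs) = p" "\<forall>x\<in>set (xs @ ys). x < m"
      by blast
    then have "m \<notin> set (xs @ ys)"
      by blast
    moreover have "Max (set s) = m"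
      using s by (intro Max_set_eqI) (auto simp: less_imp_le)
    ultimately show ?L
      using s that by (auto simp: count_list_0_iff nth_append)
  qed
  then have "single_max_seqs n m p = {s \<in> inv_seqs_avoiding n {[0, 0, 0], [2, 0, 1]}.
      Max (set s) = m \<and> count_list s m = 1 \<and> p \<in> {1..n} \<and> s ! (p - 1) = m}"
    unfolding single_max_seqs_def inv_seqs_avoiding_iff by blast
  then show ?thesis
    by (simp add: single_max_count_def)
qed

lemma card_double_max_seqs:
  "card (double_max_seqs (Suc n) m p) = (Suc n - p) * card (single_max_seqs n m p)"
proof -
  \<comment> \<open>\<open>q\<close> is the number of entries before the new \<open>m\<close>:
    \<open>q = p\<close> puts it right after the first \<open>m\<close>, \<open>q = n\<close> at the
    end. This gives \<open>Suc n - p\<close> choices.\<close>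
  define ins where "ins = (\<lambda>(s, q). take q s @ m # drop q s)"
  have split: "\<exists>xs ys zs. s = xs @ m # ys @ zs \<and> Suc (length xs) = p \<and>
      q = p + length ys \<and> (\<forall>x\<in>set (xs @ ys @ zs). x < m) \<and>
      ins (s, q) = xs @ m # ys @ m # zs"
    if s_in: "s \<in> single_max_seqs n m p" and q: "q \<in> {p..<Suc n}" for s q
  proof -
    obtain xs ys where s: "s = xs @ m # ys" "Suc (length xs) = p" "\<forall>x\<in>set (xs @ ys). x < m"
      and "length s = n"
      using s_in unfolding single_max_seqs_def inv_seqs_avoiding_iff by blast
    moreover have "q = p + length (take (q - p) ys)"
      using q s \<open>length s = n\<close> by auto
    moreover have "ins (s, q) = xs @ m # take (q - p) ys @ m # drop (q - p) ys"
      using q s by (auto simp: ins_def take_Cons' drop_Cons')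
    moreover have "set (take (q - p) ys @ drop (q - p) ys) = set ys"
      by simp
    ultimately show ?thesis
      by (metis append_take_drop_id)
  qed
  have "inj_on ins (single_max_seqs n m p \<times> {p..<Suc n})"
  proof (rule inj_onI, clarify)
    fix s q s' q'
    assume A: "s \<in> single_max_seqs n m p" "q \<in> {p..<Suc n}"
      "s' \<in> single_max_seqs n m p" "q' \<in> {p..<Suc n}" and eq: "ins (s, q) = ins (s', q')"
    obtain xs ys zs where 1: "s = xs @ m # ys @ zs" "Suc (length xs) = p"
      "q = p + length ys" "\<forall>x\<in>set (xs @ ys @ zs). x < m" "ins (s, q) = xs @ m # ys @ m # zs"
      using split[OF A(1,2)] by blast
    obtain xs' ys' zs' where 2: "s' = xs' @ m # ys' @ zs'" "Suc (length xs') = p"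
      "q' = p + length ys'" "\<forall>x\<in>set (xs' @ ys' @ zs'). x < m"
      "ins (s', q') = xs' @ m # ys' @ m # zs'"
      using split[OF A(3,4)] by blast
    \<comment> \<open>Both prefixes have length \<open>p - 1\<close>, so they agree; the remaining
      \<open>m\<close> then determines where the tails are split.\<close>
    have "xs = xs' \<and> ys @ m # zs = ys' @ m # zs'"
      using eq 1(2,5) 2(2,5) by simp
    moreover have "m \<notin> set ys" "m \<notin> set zs" "m \<notin> set ys'" "m \<notin> set zs'"
      using 1(4) 2(4) by auto
    ultimately have "xs = xs' \<and> ys = ys' \<and> zs = zs'"
      by (metis append_Cons_eq_iff)
    then show "s = s' \<and> q = q'"
      using 1 2 by simp
  qed
  moreover have "ins ` (single_max_seqs n m p \<times> {p..<Suc n}) = double_max_seqs (Suc n) m p"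
  proof (intro equalityI subsetI)
    fix t assume "t \<in> ins ` (single_max_seqs n m p \<times> {p..<Suc n})"
    then obtain s q where sq: "s \<in> single_max_seqs n m p" "q \<in> {p..<Suc n}" "t = ins (s, q)"
      by auto
    then obtain xs ys zs where t: "s = xs @ m # ys @ zs" "Suc (length xs) = p"
      "\<forall>x\<in>set (xs @ ys @ zs). x < m" "t = xs @ m # ys @ m # zs"
      using split[OF sq(1,2)] by auto
    have "s \<in> inv_seqs_avoiding n {[0, 0, 0], [2, 0, 1]}"
      using sq by (simp add: single_max_seqs_def)
    then have "t \<in> inv_seqs_avoiding (Suc n) {[0, 0, 0], [2, 0, 1]}"
      using t inv_seqs_avoiding_insert_max by simp
    then show "t \<in> double_max_seqs (Suc n) m p"
      using t unfolding double_max_seqs_def by blast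
  next
    fix t assume "t \<in> double_max_seqs (Suc n) m p"
    then obtain xs ys zs where t: "t = xs @ m # ys @ m # zs" "Suc (length xs) = p"
      "\<forall>x\<in>set (xs @ ys @ zs). x < m"
      and "t \<in> inv_seqs_avoiding (Suc n) {[0, 0, 0], [2, 0, 1]}"
      unfolding double_max_seqs_def by blast
    then have s: "xs @ m # ys @ zs \<in> inv_seqs_avoiding n {[0, 0, 0], [2, 0, 1]}"
      using inv_seqs_avoiding_insert_max by blast
    then have "xs @ m # ys @ zs \<in> single_max_seqs n m p"
      using t unfolding single_max_seqs_def by blast
    \<comment> \<open>The preimage deletes the second \<open>m\<close> and records how many entries
      stood before it.\<close>
    moreover have "p + length ys \<in> {p..<Suc n}"
      using s t by (auto simp: inv_seqs_avoiding_iff)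
    moreover have "t = ins (xs @ m # ys @ zs, p + length ys)"
      using t by (auto simp: ins_def)
    ultimately show "t \<in> ins ` (single_max_seqs n m p \<times> {p..<Suc n})"
      by blast
  qed
  ultimately have "card (double_max_seqs (Suc n) m p) =
      card (single_max_seqs n m p \<times> {p..<Suc n})"
    by (metis card_image)
  then show ?thesis
    by (simp add: card_cartesian_product)
qed

text \<open>The statistic whose fibers are indexed by the pairs \<open>(m, p)\<close> of the double
  sum.\<close>

definition first_max :: "nat list \<Rightarrow> nat \<times> nat" where
  "first_max s = (Max (set s), Suc (length (takeWhile (\<lambda>x. x \<noteq> Max (set s)) s)))"

lemma first_max_append:
  assumes "\<forall>x\<in>set xs. x < m" "\<forall>x\<in>set ys. x \<le> m"
  shows "first_max (xs @ m # ys) = (m, Suc (length xs))"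
proof -
  have "Max (set (xs @ m # ys)) = m"
    using assms by (intro Max_set_eqI) (auto simp: less_imp_le)
  moreover have "takeWhile (\<lambda>x. x \<noteq> m) (xs @ m # ys) = xs"
    using assms(1) by (subst takeWhile_append2) auto
  ultimately show ?thesis
    by (simp add: first_max_def)
qed

lemma first_max_decomp:
  fixes s :: "'a::linorder list"
  assumes "s \<noteq> []"
  obtains xs m ys where "s = xs @ m # ys" "\<forall>x\<in>set xs. x < m" "\<forall>x\<in>set ys. x \<le> m"
proof -
  have "Max (set s) \<in> set s"
    using assms by (intro Max_in) auto
  then obtain xs ys where s: "s = xs @ Max (set s) # ys" "Max (set s) \<notin> set xs"
    by (metis split_list_first)
  moreover have "\<forall>x\<in>set s. x \<le> Max (set s)"
    by simp
  ultimately have "\<forall>x\<in>set xs. x < Max (set s)" "\<forall>x\<in>set ys. x \<le> Max (set s)"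
    by (metis Un_iff order_le_imp_less_or_eq set_append, metis Un_iff list.set_intros(2) set_append)
  then show thesis
    using s(1) by (intro that)
qed

lemma first_max_fiber:
  assumes "n > 0"
  shows "{s \<in> inv_seqs_avoiding n {[0, 0, 0], [2, 0, 1]}. first_max s = (m, p)} =
         single_max_seqs n m p \<union> double_max_seqs n m p"
proof (intro equalityI subsetI)
  fix s assume s: "s \<in> {s \<in> inv_seqs_avoiding n {[0, 0, 0], [2, 0, 1]}. first_max s = (m, p)}"
  then have "s \<noteq> []"
    using assms by (auto simp: inv_seqs_avoiding_iff)
  then obtain xs ys where d: "s = xs @ m # ys" "\<forall>x\<in>set xs. x < m" "\<forall>x\<in>set ys. x \<le> m"
    and p: "Suc (length xs) = p"
    using s first_max_append by (auto elim!: first_max_decomp)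
  show "s \<in> single_max_seqs n m p \<union> double_max_seqs n m p"
  proof (cases "m \<in> set ys")
    case True
    then obtain us vs where ys: "ys = us @ m # vs"
      by (meson split_list)
    have "count_list s m \<le> 2"
      using s by (simp add: inv_seqs_avoiding_iff)
    \<comment> \<open>The two displayed copies of \<open>m\<close> exhaust the multiplicity allowed
      by 000.\<close>
    then have "count_list us m = 0" "count_list vs m = 0"
      by (simp_all add: d ys)
    then have "m \<notin> set us" "m \<notin> set vs"
      by (simp_all add: count_list_0_iff)
    then have "\<forall>x\<in>set (xs @ us @ vs). x < m"
      using d(2,3) by (auto simp: ys less_le)
    then show ?thesis
      using s d(1) p ys unfolding double_max_seqs_def by blast
  next
    case False
    then have "\<forall>x\<in>set (xs @ ys). x < m"
      using d(2,3) by (auto simp: less_le)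
    then show ?thesis
      using s d(1) p unfolding single_max_seqs_def by blast
  qed
next
  fix s assume "s \<in> single_max_seqs n m p \<union> double_max_seqs n m p"
  then show "s \<in> {s \<in> inv_seqs_avoiding n {[0, 0, 0], [2, 0, 1]}. first_max s = (m, p)}"
    by (auto simp: single_max_seqs_def double_max_seqs_def first_max_append less_imp_le)
qed

lemma single_double_max_seqs_disjoint: "single_max_seqs n m p \<inter> double_max_seqs n m p = {}"
proof -
  have "count_list s m = 1" if "s \<in> single_max_seqs n m p" for s
    using that by (force simp: single_max_seqs_def count_list_0_iff)
  moreover have "count_list s m \<ge> 2" if "s \<in> double_max_seqs n m p" for s
    using that by (auto simp: double_max_seqs_def)
  ultimately show ?thesis
    by fastforce
qed

text \<open>The first \<open>m\<close> has index \<open>length xs\<close>, so the inversion bound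
  gives \<open>m < p\<close>, the lower limit of the inner sum.\<close>

lemma first_max_range:
  assumes "n > 0" "s \<in> inv_seqs_avoiding n {[0, 0, 0], [2, 0, 1]}"
  shows "first_max s \<in> (SIGMA m:{0..n-1}. {m+1..n})"
proof -
  have len: "length s = n" and inv: "\<forall>k<n. s ! k \<le> k"
    using assms by (auto simp: inv_seqs_avoiding_iff)
  then have "s \<noteq> []"
    using assms by auto
  then obtain xs m ys where d: "s = xs @ m # ys" "\<forall>x\<in>set xs. x < m" "\<forall>x\<in>set ys. x \<le> m"
    by (rule first_max_decomp)
  have "m \<le> length xs"
    using inv len d(1) by (auto dest: spec[of _ "length xs"])
  then show ?thesis
    using len d by (auto simp: first_max_append)
qed

theorem theorem5:
  fixes n :: nat
  assumes "n \<ge> 2"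
  shows "card (inv_seqs_avoiding n {[0, 0, 0], [2, 0, 1]}) =
    (\<Sum>m=0..n-1. \<Sum>p=m+1..n. single_max_count n m p + (n - p) * single_max_count (n - 1) m p)"
proof -
  let ?I = "inv_seqs_avoiding n {[0, 0, 0], [2, 0, 1]}"
  let ?T = "SIGMA m:{0..n-1}. {m+1..n}"
  have n: "n > 0" "Suc (n - 1) = n"
    using assms by auto
  have fiber: "card {s \<in> ?I. first_max s = (m, p)} =
      single_max_count n m p + (n - p) * single_max_count (n - 1) m p" for m p
  proof -
    have "finite (single_max_seqs n m p)" "finite (double_max_seqs n m p)"
      using finite_inv_seqs_avoiding by (simp_all add: single_max_seqs_def double_max_seqs_def)
    \<comment> \<open>Reading \<open>n\<close> as \<open>Suc (n - 1)\<close> turns the factor in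
      \<open>card_double_max_seqs\<close> into \<open>n - p\<close>.\<close>
    then show ?thesis
      using card_double_max_seqs[of "n - 1" m p] n
      by (simp add: first_max_fiber single_max_count_eq card_Un_disjoint
          single_double_max_seqs_disjoint)
  qed
  have "first_max ` ?I \<subseteq> ?T"
    using first_max_range[OF n(1)] by (rule image_subsetI)
  \<comment> \<open>Grouping the constant 1 by the value of \<open>first_max\<close> counts the set
    fiber by fiber.\<close>
  then have "card ?I = (\<Sum>y\<in>?T. card {s \<in> ?I. first_max s = y})"
    using sum.group[of ?I ?T first_max "\<lambda>_. 1::nat"]
    by (simp add: finite_inv_seqs_avoiding)
  also have "\<dots> = (\<Sum>m=0..n-1. \<Sum>p=m+1..n. card {s \<in> ?I. first_max s = (m, p)})"
    by (subst sum.Sigma) (auto intro!: sum.cong)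
  finally show ?thesis
    by (simp only: fiber)
qed

end
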